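(* Let $s=(s_k)_{k\in\mathbb{N}}$ be a sequence of non-negative real numbers with $\sum_{k=1}^\infty s_k=\infty$. Then the summable filter $\mathfrak{F}^s=\{\mathbb{N}\setminus A : A\subset\mathbb{N},\ \sum_{k\in A}s_k<\infty\}$ is conglomerated.
   Context: A filter on $\mathbb{N}$ is a non-empty collection of subsets of $\mathbb{N}$ not containing $\emptyset$, closed under finite intersections and supersets. It is free if it contains every subset with finite complement. For a filter $\mathfrak{F}$ put $\mathcal{I}(\mathfrak{F})=\{\mathbb{N}\setminus A : A\in\mathfrak{F}\}$ and $\mathfrak{G}(\mathfrak{F})=2^{\mathbb{N}}\setminus\mathcal{I}(\mathfrak{F})$, where $2^{\mathbb{N}}$ is the collection of all subsets of $\mathbb{N}$. A free filter $\mathfrak{F}$ on $\mathbb{N}$ is conglomerated if there is a sequence of pairwise disjoint sets $D_n\in\mathcal{I}(\mathfrak{F})$, $n\in\mathbb{N}$, such that $\bigcup_{n\in M}D_n\in\mathfrak{G}(\mathfrak{F})$ for every infinite subset $M\subset\mathbb{N}$. *)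

theory Defs
  imports "HOL-Analysis.Analysis"
begin

text \<open>
  Filters on \<open>nat\<close> are represented, as in the source, by collections of subsets. The library type
  \<open>nat filter\<close> also contains the improper filter \<open>bot\<close>, and defining the summable filter as a value
  of that type would hide the claim that it is a filter. Lemma \<open>filter_on_nat_iff_is_filter\<close> relates
  the two notions.
\<close>

definition filter_on_nat :: "nat set set \<Rightarrow> bool" where
  "filter_on_nat F \<longleftrightarrow>
     F \<noteq> {} \<and> {} \<notin> F \<and>
     (\<forall>A\<in>F. \<forall>B\<in>F. A \<inter> B \<in> F) \<and>
     (\<forall>A\<in>F. \<forall>B. A \<subseteq> B \<longrightarrow> B \<in> F)"

lemma filter_on_nat_iff_is_filter:
  "filter_on_nat F \<longleftrightarrow> is_filter (\<lambda>P. {k. P k} \<in> F) \<and> {} \<notin> F"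
proof
  assume F: "filter_on_nat F"
  then have "UNIV \<in> F"
    unfolding filter_on_nat_def by blast
  moreover have "{k. P k \<and> Q k} \<in> F" if "{k. P k} \<in> F" "{k. Q k} \<in> F" for P Q
    using F that unfolding filter_on_nat_def Collect_conj_eq by blast
  moreover have "{k. Q k} \<in> F" if "\<forall>k. P k \<longrightarrow> Q k" "{k. P k} \<in> F" for P Q
    using F that unfolding filter_on_nat_def by (metis Collect_mono)
  ultimately show "is_filter (\<lambda>P. {k. P k} \<in> F) \<and> {} \<notin> F"
    using F unfolding filter_on_nat_def is_filter_def by simp
next
  assume "is_filter (\<lambda>P. {k. P k} \<in> F) \<and> {} \<notin> F"
  then have F: "is_filter (\<lambda>P. {k. P k} \<in> F)" and ne: "{} \<notin> F" by auto
  have "UNIV \<in> F"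
    using is_filter.True[OF F] by simp
  moreover have "A \<inter> B \<in> F" if "A \<in> F" "B \<in> F" for A B
    using is_filter.conj[OF F, of "\<lambda>k. k \<in> A" "\<lambda>k. k \<in> B"] that
    by (simp add: Int_def)
  moreover have "B \<in> F" if "A \<in> F" "A \<subseteq> B" for A B
    using is_filter.mono[OF F, of "\<lambda>k. k \<in> A" "\<lambda>k. k \<in> B"] that by auto
  ultimately show "filter_on_nat F"
    using ne unfolding filter_on_nat_def by blast
qed

definition free_filter :: "nat set set \<Rightarrow> bool" where
  "free_filter F \<longleftrightarrow> filter_on_nat F \<and> (\<forall>A. finite (- A) \<longrightarrow> A \<in> F)"

definition filter_ideal :: "nat set set \<Rightarrow> nat set set" where
  "filter_ideal F = {- A | A. A \<in> F}"

definition filter_grill :: "nat set set \<Rightarrow> nat set set" where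
  "filter_grill F = Pow UNIV - filter_ideal F"

definition conglomerated :: "nat set set \<Rightarrow> bool" where
  "conglomerated F \<longleftrightarrow>
     free_filter F \<and>
     (\<exists>D :: nat \<Rightarrow> nat set.
        disjoint_family D \<and>
        (\<forall>n. D n \<in> filter_ideal F) \<and>
        (\<forall>M. infinite M \<longrightarrow> (\<Union>n\<in>M. D n) \<in> filter_grill F))"

text \<open>
  The sum is taken in \<open>ennreal\<close>, so that it always exists and being \<open>< \<infinity>\<close> is meaningful. Since
  \<open>ennreal\<close> sends negative reals to \<open>0\<close>, the definition is intended for non-negative \<open>s\<close> only.
\<close>

definition summable_filter :: "(nat \<Rightarrow> real) \<Rightarrow> nat set set" where
  "summable_filter s = {- A | A. (\<Sum>\<^sub>\<infinity>k\<in>A. ennreal (s k)) < \<infinity>}"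

end

theory Submission
  imports Defs
begin

text \<open>
  Passing to complements turns the statement into one about the ideal of sets of finite weight.
  Since the total weight is infinite while each single weight is finite, every tail of the series
  still diverges, so \<open>nat\<close> can be cut greedily into consecutive finite intervals, each of weight at
  least \<open>1\<close> (lemma \<open>exists_disjoint_heavy_blocks\<close>). Each interval is finite, hence of finite
  weight; but infinitely many of them together have infinite weight, because any \<open>c\<close> of them already
  contribute at least \<open>c\<close> (lemma \<open>infsum_heavy_union\<close>). These intervals witness
  conglomeration. The same estimate, applied to all the intervals at once, shows that \<open>nat\<close> itself
  has infinite weight, which is what makes the summable filter proper.
\<close>

lemma filter_ideal_summable_filter:
  "A \<in> filter_ideal (summable_filter s) \<longleftrightarrow> (\<Sum>\<^sub>\<infinity>k\<in>A. ennreal (s k)) < \<infinity>"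
  by (auto simp: filter_ideal_def summable_filter_def)

lemma summable_filter_iff:
  "B \<in> summable_filter s \<longleftrightarrow> (\<Sum>\<^sub>\<infinity>k\<in>- B. ennreal (s k)) < \<infinity>"
  unfolding summable_filter_def by (auto intro!: exI[of _ "- B"])

lemma infsum_mono_set_ennreal:
  fixes f :: "'a \<Rightarrow> ennreal"
  assumes "A \<subseteq> B"
  shows "infsum f A \<le> infsum f B"
  using assms by (intro infsum_mono_neutral) (auto simp: nonneg_summable_on_complete)

lemma infsum_Un_le_ennreal:
  fixes f :: "'a \<Rightarrow> ennreal"
  shows "infsum f (A \<union> B) \<le> infsum f A + infsum f B"
proof -
  have "infsum f (A \<union> (B - A)) = infsum f A + infsum f (B - A)"
    by (intro infsum_Un_disjoint) (auto simp: nonneg_summable_on_complete)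
  also have "\<dots> \<le> infsum f A + infsum f B"
    by (intro add_left_mono infsum_mono_set_ennreal) auto
  finally show ?thesis by simp
qed

text \<open>
  Removing the finitely many terms below \<open>m\<close>, each of them finite, cannot make a divergent series
  converge, so the partial sums starting at \<open>m\<close> exceed \<open>1\<close> eventually.
\<close>

lemma exists_heavy_block_from:
  fixes f :: "nat \<Rightarrow> ennreal"
  assumes fin: "\<And>k. f k < \<infinity>" and inf: "(\<Sum>k. f k) = \<infinity>"
  shows "\<exists>n>m. 1 \<le> sum f {m..<n}"
proof -
  have "(\<Sum>k. f k) = (\<Sum>k. f (k + m)) + sum f {..<m}"
    by (rule suminf_offset) auto
  moreover have "sum f {..<m} < \<infinity>"
    using fin by simp
  ultimately have "(\<Sum>k. f (k + m)) = \<infinity>"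
    using inf by (metis ennreal_add_eq_top infinity_ennreal_def less_irrefl)
  then have "1 < (SUP n. \<Sum>k<n. f (k + m))"
    by (simp only: suminf_eq_SUP infinity_ennreal_def ennreal_one_less_top)
  then obtain n where n: "1 < (\<Sum>k<n. f (k + m))"
    by (auto simp: less_SUP_iff)
  moreover have "(\<Sum>k<n. f (k + m)) = sum f {m..<n + m}"
    using sum.shift_bounds_nat_ivl[of f 0 m n] by (simp add: atLeast0LessThan)
  moreover have "n \<noteq> 0"
    using n by (rule contrapos_pn) simp
  ultimately show ?thesis
    by (intro exI[of _ "n + m"]) auto
qed

lemma disjoint_family_consecutive_blocks:
  fixes N :: "nat \<Rightarrow> nat"
  assumes "mono N"
  shows "disjoint_family (\<lambda>n. {N n..<N (Suc n)})"
proof -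
  have "{N i..<N (Suc i)} \<inter> {N j..<N (Suc j)} = {}" if "i < j" for i j
    using monoD[OF assms, of "Suc i" j] that by auto
  then show ?thesis
    unfolding disjoint_family_on_def by (metis Int_commute linorder_neqE_nat)
qed

lemma exists_disjoint_heavy_blocks:
  fixes f :: "nat \<Rightarrow> ennreal"
  assumes "\<And>k. f k < \<infinity>" and "(\<Sum>k. f k) = \<infinity>"
  shows "\<exists>D :: nat \<Rightarrow> nat set. disjoint_family D \<and> (\<forall>n. finite (D n) \<and> 1 \<le> sum f (D n))"
proof -
  obtain N :: "nat \<Rightarrow> nat" where N: "\<And>n. N n < N (Suc n)" "\<And>n. 1 \<le> sum f {N n..<N (Suc n)}"
    using dependent_nat_choice[of "\<lambda>_ _. True" "\<lambda>_ m n. m < n \<and> 1 \<le> sum f {m..<n}"]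
      exists_heavy_block_from[OF assms] by auto
  have "mono N"
    using N(1) by (intro incseq_SucI less_imp_le)
  then show ?thesis
    using N(2) disjoint_family_consecutive_blocks
    by (intro exI[of _ "\<lambda>n. {N n..<N (Suc n)}"]) auto
qed

text \<open>
  Any \<open>c\<close> of the blocks are disjoint, so they bound the weight of the union below by \<open>c\<close>; and an
  infinite \<open>M\<close> supplies \<open>c\<close> blocks for every \<open>c\<close>.
\<close>

lemma infsum_heavy_union:
  fixes f :: "'a \<Rightarrow> ennreal"
  assumes disj: "disjoint_family_on D M"
    and heavy: "\<And>n. n \<in> M \<Longrightarrow> finite (D n) \<and> 1 \<le> sum f (D n)"
    and M: "infinite M"
  shows "infsum f (\<Union>n\<in>M. D n) = \<infinity>"
proof -
  have "of_nat c \<le> infsum f (\<Union>n\<in>M. D n)" for c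
  proof -
    obtain C where C: "C \<subseteq> M" "finite C" "card C = c"
      using infinite_arbitrarily_large[OF M, of c] by auto
    have "of_nat c = (\<Sum>n\<in>C. 1 :: ennreal)"
      using C by simp
    also have "\<dots> \<le> (\<Sum>n\<in>C. sum f (D n))"
      using C(1) heavy by (intro sum_mono) auto
    also have "\<dots> = sum f (\<Union>n\<in>C. D n)"
      using C heavy disjoint_family_on_mono[OF C(1) disj]
      by (intro sum.UNION_disjoint[symmetric]) (auto simp: disjoint_family_on_def)
    also have "\<dots> = infsum f (\<Union>n\<in>C. D n)"
      using C heavy by (intro infsum_finite[symmetric]) auto
    also have "\<dots> \<le> infsum f (\<Union>n\<in>M. D n)"
      using C(1) by (intro infsum_mono_set_ennreal) auto
    finally show ?thesis .
  qed
  then show ?thesis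
    by (metis ennreal_Ex_less_of_nat infinity_ennreal_def leD top.not_eq_extremum)
qed

lemma free_filter_summable_filter:
  assumes "infsum (\<lambda>k. ennreal (s k)) UNIV = \<infinity>"
  shows "free_filter (summable_filter s)"
  unfolding free_filter_def filter_on_nat_def
proof (intro conjI ballI allI impI)
  show "B \<in> summable_filter s" if "finite (- B)" for B
    using that by (simp add: summable_filter_iff)
  from this[of UNIV] show "summable_filter s \<noteq> {}"
    by auto
  show "{} \<notin> summable_filter s"
    using assms by (simp add: summable_filter_iff)
  fix A B
  assume A: "A \<in> summable_filter s"
  show "A \<inter> B \<in> summable_filter s" if "B \<in> summable_filter s"
    using A that infsum_Un_le_ennreal[of "\<lambda>k. ennreal (s k)" "- A" "- B"]
    by (auto simp: summable_filter_iff intro: le_less_trans)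
  show "B \<in> summable_filter s" if "A \<subseteq> B"
    using A that infsum_mono_set_ennreal[of "- B" "- A" "\<lambda>k. ennreal (s k)"]
    by (auto simp: summable_filter_iff intro: le_less_trans)
qed

theorem theorem2p6:
  fixes s :: "nat \<Rightarrow> real"
  assumes "\<And>k. s k \<ge> 0"
    and "(\<Sum>k. ennreal (s k)) = \<infinity>"
  shows "conglomerated (summable_filter s)"
proof -
  obtain D :: "nat \<Rightarrow> nat set" where disj: "disjoint_family D"
    and D: "\<And>n. finite (D n) \<and> 1 \<le> (\<Sum>k\<in>D n. ennreal (s k))"
    using exists_disjoint_heavy_blocks[of "\<lambda>k. ennreal (s k)"] assms(2) by auto
  have heavy: "(\<Sum>\<^sub>\<infinity>k\<in>(\<Union>n\<in>M. D n). ennreal (s k)) = \<infinity>" if "infinite M" for M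
    using disjoint_family_on_mono[OF subset_UNIV disj] D that by (intro infsum_heavy_union)
  have "infsum (\<lambda>k. ennreal (s k)) UNIV = \<infinity>"
    using heavy[of UNIV] infsum_mono_set_ennreal[of "\<Union>n. D n" UNIV "\<lambda>k. ennreal (s k)"]
    by (auto simp: top_unique)
  then have "free_filter (summable_filter s)"
    by (rule free_filter_summable_filter)
  moreover have "D n \<in> filter_ideal (summable_filter s)" for n
    using D by (simp add: filter_ideal_summable_filter)
  moreover have "(\<Union>n\<in>M. D n) \<in> filter_grill (summable_filter s)" if "infinite M" for M
    using heavy[OF that] by (simp add: filter_grill_def filter_ideal_summable_filter)
  ultimately show ?thesis
    unfolding conglomerated_def using disj by blast
qed

end
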